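(* Against a credible agent, incentive compatible (IC) two-stage mechanisms can be arbitrarily worse than general two-stage (elicitation-then-signaling) mechanisms: for every $K>0$ there exists an instance in which the ratio between the maximum expected payoff of the principal over all two-stage mechanisms and the maximum expected payoff of the principal over all IC two-stage mechanisms is larger than $K$.
   Context: An instance consists of finite sets $\Theta$ (states), $A$ (actions), $T$ (agent types), a prior $\mu\in\Delta(\Theta)$, a type distribution $\rho\in\Delta(T)$, a principal payoff function $v(\theta,a)$ and agent payoff functions $u_t(\theta,a)$, $t\in T$. The state $\theta\sim\mu$ is observed only by the principal; the agent's type $t\sim\rho$, independent of $\theta$, is known only to the agent. Two-stage mechanism: the principal commits to signaling strategies $\pi_{t'}:\Theta\to\Delta(G)$, $t'\in T$, with $G$ a finite signal set. The agent (true type $t$) reports a type $t'\in T$; the principal sends $g\sim\pi_{t'}(\cdot\mid\theta)$; the agent plays an action $a$; the principal gets $v(\theta,a)$, the agent gets $u_t(\theta,a)$. Credible agent: after reporting $t'$ and receiving $g$, the agent must play an action in $\arg\max_{a\in A}\sum_\theta \mu(\theta)\pi_{t'}(g\mid\theta)u_{t'}(\theta,a)$, even if his true type is $t\neq t'$. The agent chooses the report to maximize his expected payoff under his true payoff function $u_t$. Ties are broken as the mechanism decides. The mechanism is IC if, for every $t\in T$, reporting $t'=t$ is optimal for an agent of true type $t$ and the agent does so. *)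

theory Defs
  imports "HOL-Probability.Probability_Mass_Function"
begin

record ('s, 'a, 't) persuasion_instance =
  state_set :: "'s set"
  action_set :: "'a set"
  type_set :: "'t set"
  prior :: "'s pmf"
  type_dist :: "'t pmf"
  principal_util :: "'s \<Rightarrow> 'a \<Rightarrow> real"
  agent_util :: "'t \<Rightarrow> 's \<Rightarrow> 'a \<Rightarrow> real"

definition valid_instance :: "('s, 'a, 't) persuasion_instance \<Rightarrow> bool" where
  "valid_instance I \<longleftrightarrow>
     finite (state_set I) \<and> finite (action_set I) \<and> finite (type_set I) \<and>
     state_set I \<noteq> {} \<and> action_set I \<noteq> {} \<and> type_set I \<noteq> {} \<and>
     set_pmf (prior I) \<subseteq> state_set I \<and> set_pmf (type_dist I) \<subseteq> type_set I"

text \<open>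
  Since ties are broken as the mechanism decides, a mechanism carries, besides its signaling
  strategies, the agent's behaviour: the report \<open>report M t\<close> of each true type \<open>t\<close> and the action
  \<open>response M t' g\<close> played after report \<open>t'\<close> and signal \<open>g\<close>.  That both are optimal for a
  credible agent is required in \<open>two_stage_mechanism\<close> below.
\<close>

record ('s, 'a, 't, 'g) mechanism =
  signal_set :: "'g set"
  signaling :: "'t \<Rightarrow> 's \<Rightarrow> 'g pmf"
  response :: "'t \<Rightarrow> 'g \<Rightarrow> 'a"
  report :: "'t \<Rightarrow> 't"

definition credible_response ::
  "('s, 'a, 't) persuasion_instance \<Rightarrow> ('s, 'a, 't, 'g) mechanism \<Rightarrow> 't \<Rightarrow> 'g \<Rightarrow> 'a \<Rightarrow> bool" where
  "credible_response I M t' g =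
     is_arg_max
       (\<lambda>a. \<Sum>\<theta>\<in>state_set I. pmf (prior I) \<theta> * pmf (signaling M t' \<theta>) g * agent_util I t' \<theta> a)
       (\<lambda>a. a \<in> action_set I)"

text \<open>Expected value of a payoff function \<open>w\<close> (the principal's or an agent type's) when the report
  is \<open>t'\<close>.\<close>

definition report_payoff ::
  "('s, 'a, 't) persuasion_instance \<Rightarrow> ('s, 'a, 't, 'g) mechanism \<Rightarrow> ('s \<Rightarrow> 'a \<Rightarrow> real) \<Rightarrow> 't \<Rightarrow> real"
  where
  "report_payoff I M w t' =
     (\<Sum>\<theta>\<in>state_set I. \<Sum>g\<in>signal_set M.
        pmf (prior I) \<theta> * pmf (signaling M t' \<theta>) g * w \<theta> (response M t' g))"

definition optimal_report ::
  "('s, 'a, 't) persuasion_instance \<Rightarrow> ('s, 'a, 't, 'g) mechanism \<Rightarrow> 't \<Rightarrow> 't \<Rightarrow> bool" where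
  "optimal_report I M t =
     is_arg_max (report_payoff I M (agent_util I t)) (\<lambda>t'. t' \<in> type_set I)"

definition two_stage_mechanism ::
  "('s, 'a, 't) persuasion_instance \<Rightarrow> ('s, 'a, 't, 'g) mechanism \<Rightarrow> bool" where
  "two_stage_mechanism I M \<longleftrightarrow>
     finite (signal_set M) \<and>
     (\<forall>t'\<in>type_set I. \<forall>\<theta>\<in>state_set I. set_pmf (signaling M t' \<theta>) \<subseteq> signal_set M) \<and>
     (\<forall>t'\<in>type_set I. \<forall>g\<in>signal_set M. credible_response I M t' g (response M t' g)) \<and>
     (\<forall>t\<in>type_set I. optimal_report I M t (report M t))"

definition IC_mechanism ::
  "('s, 'a, 't) persuasion_instance \<Rightarrow> ('s, 'a, 't, 'g) mechanism \<Rightarrow> bool" where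
  "IC_mechanism I M \<longleftrightarrow>
     two_stage_mechanism I M \<and> (\<forall>t\<in>type_set I. optimal_report I M t t \<and> report M t = t)"

definition principal_payoff ::
  "('s, 'a, 't) persuasion_instance \<Rightarrow> ('s, 'a, 't, 'g) mechanism \<Rightarrow> real" where
  "principal_payoff I M =
     (\<Sum>t\<in>type_set I. pmf (type_dist I) t * report_payoff I M (principal_util I) (report M t))"

end

theory Submission
  imports Defs
begin

text \<open>
  Two equally likely states \<open>0, 1\<close>. Each state \<open>\<theta>\<close> has two matching actions: \<open>\<theta>\<close>, worth \<open>1\<close> to the
  principal, and \<open>\<theta> + 2\<close>, worth only \<open>d\<close>. The rare type \<open>0\<close>, of probability \<open>d\<close>, wants to play
  exactly \<open>\<theta>\<close>. The common type \<open>1\<close> wants to match the state, but gains \<open>3\<close> from the matching action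
  \<open>\<theta> + 2\<close> and only \<open>2\<close> from the matching action \<open>\<theta>\<close>. So a truthful type \<open>1\<close> always ends up in
  \<open>{2, 3}\<close>, and an IC mechanism is worth at most \<open>d + (1 - d) d < 2 d\<close>. If however the state is
  revealed after the report \<open>0\<close> and hidden after the report \<open>1\<close>, then type \<open>1\<close> prefers to pose as
  type \<open>0\<close> (\<open>2\<close> against \<open>3 / 2\<close>), and credibility forces him to play \<open>\<theta>\<close>: the principal gets \<open>1\<close>.
\<close>

text \<open>Bounding the payoff separately for each signal suffices: the weights
  \<open>pmf (prior I) \<theta> * pmf (signaling M t \<theta>) g\<close> add up to 1 over all states
  and signals.\<close>

lemma report_payoff_le:
  assumes I: "valid_instance I" and M: "two_stage_mechanism I M" and t: "t \<in> type_set I"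
    and le: "\<And>g. g \<in> signal_set M \<Longrightarrow>
      (\<Sum>\<theta>\<in>state_set I. pmf (prior I) \<theta> * pmf (signaling M t \<theta>) g * w \<theta> (response M t g))
      \<le> c * (\<Sum>\<theta>\<in>state_set I. pmf (prior I) \<theta> * pmf (signaling M t \<theta>) g)"
  shows "report_payoff I M w t \<le> c"
proof -
  have mass: "(\<Sum>g\<in>signal_set M. pmf (signaling M t \<theta>) g) = 1" if "\<theta> \<in> state_set I" for \<theta>
    using M t that by (intro sum_pmf_eq_1) (auto simp: two_stage_mechanism_def)
  have "report_payoff I M w t = (\<Sum>g\<in>signal_set M. \<Sum>\<theta>\<in>state_set I.
      pmf (prior I) \<theta> * pmf (signaling M t \<theta>) g * w \<theta> (response M t g))"
    unfolding report_payoff_def by (rule sum.swap)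
  also have "\<dots> \<le> (\<Sum>g\<in>signal_set M.
      c * (\<Sum>\<theta>\<in>state_set I. pmf (prior I) \<theta> * pmf (signaling M t \<theta>) g))"
    by (intro sum_mono le)
  also have "\<dots> = c * (\<Sum>g\<in>signal_set M. \<Sum>\<theta>\<in>state_set I.
      pmf (prior I) \<theta> * pmf (signaling M t \<theta>) g)"
    by (simp add: sum_distrib_left)
  also have "\<dots> = c * (\<Sum>\<theta>\<in>state_set I. \<Sum>g\<in>signal_set M.
      pmf (prior I) \<theta> * pmf (signaling M t \<theta>) g)"
    by (subst sum.swap) simp
  also have "\<dots> = c * (\<Sum>\<theta>\<in>state_set I. pmf (prior I) \<theta>)"
    by (simp add: sum_distrib_left[symmetric] mass)
  also have "\<dots> = c"
    using I by (simp add: sum_pmf_eq_1 valid_instance_def)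
  finally show ?thesis .
qed

lemma response_in_action_set:
  assumes "two_stage_mechanism I M" "t \<in> type_set I" "g \<in> signal_set M"
  shows "response M t g \<in> action_set I"
  using assms by (auto simp: two_stage_mechanism_def credible_response_def is_arg_max_def)

definition common_util :: "nat \<Rightarrow> nat \<Rightarrow> real" where
  "common_util \<theta> a = (if a = \<theta> then 2 else if a = \<theta> + 2 then 3 else 0)"

text \<open>\<open>principal_util\<close> ignores the state: all that matters to the principal is
  whether the action is below 2. \<open>of_bool\<close> turns a Bernoulli success into type
  1.\<close>

definition gap_instance :: "real \<Rightarrow> (nat, nat, nat) persuasion_instance" where
  "gap_instance d =
     \<lparr>state_set = {0, 1}, action_set = {0, 1, 2, 3}, type_set = {0, 1},
      prior = pmf_of_set {0, 1}, type_dist = map_pmf of_bool (bernoulli_pmf (1 - d)),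
      principal_util = (\<lambda>\<theta> a. if a < 2 then 1 else d),
      agent_util = (\<lambda>t \<theta> a. if t = 0 then of_bool (a = \<theta>) else common_util \<theta> a)\<rparr>"

text \<open>After report 1 the signal is always 0. The response 2 to it breaks a tie with action 3;
  the response to signal 1 is then a filler, since that signal has probability 0.\<close>

definition posing_mechanism :: "(nat, nat, nat, nat) mechanism" where
  "posing_mechanism =
     \<lparr>signal_set = {0, 1}, signaling = (\<lambda>t \<theta>. return_pmf (if t = 0 then \<theta> else 0)),
      response = (\<lambda>t g. if t = 0 then g else g + 2), report = (\<lambda>t. 0)\<rparr>"

text \<open>Full revelation after either report; it will turn out to be an optimal IC
  mechanism.\<close>

definition truthful_mechanism :: "(nat, nat, nat, nat) mechanism" where
  "truthful_mechanism =
     \<lparr>signal_set = {0, 1}, signaling = (\<lambda>t \<theta>. return_pmf \<theta>),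
      response = (\<lambda>t g. if t = 0 then g else g + 2), report = (\<lambda>t. t)\<rparr>"

lemma pmf_type_dist_gap:
  assumes "0 \<le> d" "d \<le> 1"
  shows "pmf (map_pmf of_bool (bernoulli_pmf (1 - d))) (0 :: nat) = d"
    and "pmf (map_pmf of_bool (bernoulli_pmf (1 - d))) (Suc 0) = 1 - d"
proof -
  have inj: "inj (of_bool :: bool \<Rightarrow> nat)"
    by (auto simp: inj_def)
  show "pmf (map_pmf of_bool (bernoulli_pmf (1 - d))) (0 :: nat) = d"
    using pmf_map_inj'[OF inj, of "bernoulli_pmf (1 - d)" False] assms by simp
  show "pmf (map_pmf of_bool (bernoulli_pmf (1 - d))) (Suc 0) = 1 - d"
    using pmf_map_inj'[OF inj, of "bernoulli_pmf (1 - d)" True] assms by simp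
qed

lemma valid_gap_instance: "valid_instance (gap_instance d)"
  by (auto simp: valid_instance_def gap_instance_def)

text \<open>The uniform prior only contributes a common factor 1/2, which leaves the maximizers
  unchanged.\<close>

lemma credible_response_gap:
  "credible_response (gap_instance d) M t g a \<longleftrightarrow>
    a \<in> {0, 1, 2, 3} \<and>
    (\<forall>b\<in>{0, 1, 2, 3}.
      pmf (signaling M t 0) g * agent_util (gap_instance d) t 0 b +
      pmf (signaling M t 1) g * agent_util (gap_instance d) t 1 b
      \<le> pmf (signaling M t 0) g * agent_util (gap_instance d) t 0 a +
        pmf (signaling M t 1) g * agent_util (gap_instance d) t 1 a)"
proof -
  have eq: "(\<Sum>\<theta>\<in>state_set (gap_instance d). pmf (prior (gap_instance d)) \<theta> *
      pmf (signaling M t \<theta>) g * agent_util (gap_instance d) t \<theta> b) =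
    (pmf (signaling M t 0) g * agent_util (gap_instance d) t 0 b +
     pmf (signaling M t 1) g * agent_util (gap_instance d) t 1 b) / 2" for b
    by (simp add: gap_instance_def add_divide_distrib)
  have actions: "action_set (gap_instance d) = {0, 1, 2, 3}"
    by (simp add: gap_instance_def)
  have half: "x / 2 \<le> y / 2 \<longleftrightarrow> x \<le> y" for x y :: real
    by simp
  show ?thesis
    by (simp only: credible_response_def is_arg_max_linorder eq actions half Ball_def)
qed

lemma report_payoff_gap:
  fixes M :: "(nat, nat, nat, nat) mechanism"
  assumes "signal_set M = {0, 1}"
  shows "report_payoff (gap_instance d) M w t =
    (pmf (signaling M t 0) 0 * w 0 (response M t 0) +
     pmf (signaling M t 0) 1 * w 0 (response M t 1) +
     pmf (signaling M t 1) 0 * w 1 (response M t 0) +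
     pmf (signaling M t 1) 1 * w 1 (response M t 1)) / 2"
  by (simp add: report_payoff_def gap_instance_def assms add_divide_distrib)

lemma signals_posing: "signal_set posing_mechanism = {0, 1}"
  by (simp add: posing_mechanism_def)

lemma signals_truthful: "signal_set truthful_mechanism = {0, 1}"
  by (simp add: truthful_mechanism_def)

text \<open>Report 0 beats report 1 by 1 to 0 for type 0, and by 2 to 3/2 for type 1.\<close>

lemma two_stage_posing: "two_stage_mechanism (gap_instance d) posing_mechanism"
  unfolding two_stage_mechanism_def optimal_report_def is_arg_max_linorder
    credible_response_gap report_payoff_gap[OF signals_posing]
  by (simp add: posing_mechanism_def gap_instance_def common_util_def)

text \<open>Truth beats the lie by 1 to 0 for type 0, and by 3 to 2 for type 1.\<close>

lemma IC_truthful: "IC_mechanism (gap_instance d) truthful_mechanism"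
  unfolding IC_mechanism_def two_stage_mechanism_def optimal_report_def is_arg_max_linorder
    credible_response_gap report_payoff_gap[OF signals_truthful]
  by (simp add: truthful_mechanism_def gap_instance_def common_util_def)

lemma principal_payoff_gap:
  assumes "0 \<le> d" "d \<le> 1"
  shows "principal_payoff (gap_instance d) M =
    d * report_payoff (gap_instance d) M (principal_util (gap_instance d)) (report M 0) +
    (1 - d) * report_payoff (gap_instance d) M (principal_util (gap_instance d)) (report M 1)"
  using pmf_type_dist_gap[OF assms] by (simp add: principal_payoff_def gap_instance_def)

lemma principal_payoff_posing:
  assumes "0 \<le> d" "d \<le> 1"
  shows "principal_payoff (gap_instance d) posing_mechanism = 1"
  unfolding principal_payoff_gap[OF assms] report_payoff_gap[OF signals_posing]
  by (simp add: posing_mechanism_def gap_instance_def)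

lemma principal_payoff_truthful:
  assumes "0 \<le> d" "d \<le> 1"
  shows "principal_payoff (gap_instance d) truthful_mechanism = d + (1 - d) * d"
  unfolding principal_payoff_gap[OF assms] report_payoff_gap[OF signals_truthful]
  by (simp add: truthful_mechanism_def gap_instance_def)

lemma report_payoff_gap_le_1:
  assumes "two_stage_mechanism (gap_instance d) M" "t \<in> type_set (gap_instance d)" "d \<le> 1"
  shows "report_payoff (gap_instance d) M (principal_util (gap_instance d)) t \<le> 1"
proof (rule report_payoff_le[OF valid_gap_instance assms(1,2)])
  fix g
  show "(\<Sum>\<theta>\<in>state_set (gap_instance d).
          pmf (prior (gap_instance d)) \<theta> * pmf (signaling M t \<theta>) g *
          principal_util (gap_instance d) \<theta> (response M t g))
      \<le> 1 * (\<Sum>\<theta>\<in>state_set (gap_instance d).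
          pmf (prior (gap_instance d)) \<theta> * pmf (signaling M t \<theta>) g)"
    unfolding mult_1 using \<open>d \<le> 1\<close>
    by (intro sum_mono mult_left_le) (auto simp: gap_instance_def)
qed

text \<open>After report 1, an action below 2 can be credible only at a signal of probability 0, so
  the principal's value 1 never counts.\<close>

lemma report_payoff_gap_common_le:
  assumes M: "two_stage_mechanism (gap_instance d) M"
  shows "report_payoff (gap_instance d) M (principal_util (gap_instance d)) 1 \<le> d"
proof (rule report_payoff_le[OF valid_gap_instance M])
  show "1 \<in> type_set (gap_instance d)"
    by (simp add: gap_instance_def)
next
  fix g assume g: "g \<in> signal_set M"
  define x y where "x = pmf (signaling M 1 0) g" and "y = pmf (signaling M 1 1) g"
  have nn: "x \<ge> 0" "y \<ge> 0"
    by (simp_all add: x_def y_def)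
  have a: "response M 1 g \<in> {0, 1, 2, 3}"
    using response_in_action_set[OF M _ g, of 1] by (simp add: gap_instance_def)
  have "credible_response (gap_instance d) M 1 g (response M 1 g)"
    using M g by (simp add: two_stage_mechanism_def gap_instance_def)
  then have opt: "x * common_util 0 b + y * common_util 1 b
      \<le> x * common_util 0 (response M 1 g) + y * common_util 1 (response M 1 g)"
    if "b \<in> {0, 1, 2, 3}" for b
    using that unfolding credible_response_gap x_def y_def
    by (auto simp: gap_instance_def)
  \<comment> \<open>If the response is 0, comparison with action 2 gives 3x \<le> 2x, so x = 0;
    comparison with action 3 then gives 3y \<le> 2x = 0. Response 1 is symmetric.\<close>
  have "x = 0 \<and> y = 0" if "response M 1 g < 2"
    using a that opt[of 2] opt[of 3] nn by (auto simp: common_util_def)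
  then show "(\<Sum>\<theta>\<in>state_set (gap_instance d).
          pmf (prior (gap_instance d)) \<theta> * pmf (signaling M 1 \<theta>) g *
          principal_util (gap_instance d) \<theta> (response M 1 g))
      \<le> d * (\<Sum>\<theta>\<in>state_set (gap_instance d).
          pmf (prior (gap_instance d)) \<theta> * pmf (signaling M 1 \<theta>) g)"
    by (auto simp: gap_instance_def x_def y_def algebra_simps)
qed

lemma principal_payoff_gap_le_1:
  assumes "two_stage_mechanism (gap_instance d) M" "0 \<le> d" "d \<le> 1"
  shows "principal_payoff (gap_instance d) M \<le> 1"
proof -
  have "report M t \<in> type_set (gap_instance d)" if "t \<in> type_set (gap_instance d)" for t
    using assms(1) that
    by (auto simp: two_stage_mechanism_def optimal_report_def is_arg_max_def)
  then have "report M 0 \<in> type_set (gap_instance d)" "report M 1 \<in> type_set (gap_instance d)"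
    by (simp_all add: gap_instance_def)
  then show ?thesis
    unfolding principal_payoff_gap[OF assms(2,3)]
    using assms by (intro convex_bound_le report_payoff_gap_le_1) auto
qed

text \<open>Truthfulness ties type 1 to report 1, where the principal gets at most \<open>d\<close>;
  the rare type 0 contributes at most \<open>d\<close> in total.\<close>

lemma principal_payoff_gap_IC_le:
  assumes "IC_mechanism (gap_instance d) M" "0 \<le> d" "d \<le> 1"
  shows "principal_payoff (gap_instance d) M \<le> d + (1 - d) * d"
proof -
  have M: "two_stage_mechanism (gap_instance d) M" and r: "report M 0 = 0" "report M 1 = 1"
    using assms(1) by (auto simp: IC_mechanism_def gap_instance_def)
  have "report_payoff (gap_instance d) M (principal_util (gap_instance d)) 0 \<le> 1"
    using M assms(3) by (intro report_payoff_gap_le_1) (auto simp: gap_instance_def)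
  then show ?thesis
    unfolding principal_payoff_gap[OF assms(2,3)] r
    using report_payoff_gap_common_le[OF M] assms(2,3)
    by (intro add_mono mult_left_mono mult_left_le) auto
qed

theorem mainTheorem3:
  fixes K :: real
  assumes "K > 0"
  shows "\<exists>(I :: (nat, nat, nat) persuasion_instance)
          (M :: (nat, nat, nat, nat) mechanism) (N :: (nat, nat, nat, nat) mechanism).
           valid_instance I \<and>
           is_arg_max (principal_payoff I) (two_stage_mechanism I) M \<and>
           is_arg_max (principal_payoff I) (IC_mechanism I) N \<and>
           principal_payoff I N > 0 \<and>
           principal_payoff I M / principal_payoff I N > K"
proof -
  \<comment> \<open>Chosen so that 2d = 1 / (K + 1): since \<open>?p\<close> \<le> 2d, this yields K
    * \<open>?p\<close> < 1.\<close>
  define d where "d = 1 / (2 * K + 2)"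
  have d: "0 < d" "d \<le> 1"
    using assms by (simp_all add: d_def)
  let ?p = "d + (1 - d) * d"
  have pos: "?p > 0"
    using d by (simp add: add_pos_nonneg)
  have "K * ?p \<le> K * (2 * d)"
    using assms d by (intro mult_left_mono) (auto simp: algebra_simps)
  also have "\<dots> < 1"
    using assms by (simp add: d_def field_simps)
  finally have "1 / ?p > K"
    using pos by (simp add: pos_less_divide_eq)
  with pos d show ?thesis
    \<comment> \<open>The two witnesses attain the upper bounds 1 and \<open>?p\<close>, so both are
      maximizers and the ratio of the maxima is 1 / \<open>?p\<close>.\<close>
    by (intro exI[of _ "gap_instance d"] exI[of _ posing_mechanism] exI[of _ truthful_mechanism])
      (simp add: is_arg_max_linorder valid_gap_instance two_stage_posing IC_truthful
        principal_payoff_posing principal_payoff_truthful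
        principal_payoff_gap_le_1 principal_payoff_gap_IC_le)
qed

end
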